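(* Let $\delta$ be a positive integer. (i) Every finite oriented graph $D$ with $\delta^+(D)\geq\delta$ contains a directed path of length at least $1.5\delta$. (ii) Every finite digraph $D$ with $\delta^+(D)\geq\delta$ and girth $g\geq 4$ contains a directed path of length at least $1.6535\delta$.
   Context: An oriented graph is a digraph with no 2-cycles, i.e. obtained by orienting the edges of a simple graph. $\delta^+(D)$ is the minimum out-degree. The girth is the minimum length of a directed cycle. The length of a path is its number of arcs. *)

theory Defs
  imports Complex_Main "HOL-Library.Extended_Nat" "Graph_Theory.Graph_Theory"
begin

text \<open>
  Digraphs are those of the locale \<^locale>\<open>digraph\<close>: finite, without loops and without parallel
  arcs, but possibly with 2-cycles. A directed path is an \<open>apath\<close>; it is given by its list of
  arcs, so its length in the graph-theoretic sense is the length of that list.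
\<close>

locale oriented_graph = digraph +
  assumes no_2_cycle: "cycle p \<Longrightarrow> length p \<noteq> 2"

text \<open>Only meaningful if \<open>G\<close> has finitely many vertices and at least one.\<close>
definition min_out_degree :: "('a, 'b) pre_digraph \<Rightarrow> nat" where
  "min_out_degree G = Min (out_degree G ` verts G)"

text \<open>The girth of an acyclic digraph is \<open>\<infinity>\<close>.\<close>
definition girth :: "('a, 'b) pre_digraph \<Rightarrow> enat" where
  "girth G = (INF p \<in> {p. pre_digraph.cycle G p}. enat (length p))"

lemma oriented_graph_iff:
  "oriented_graph G \<longleftrightarrow>
     digraph G \<and> (\<forall>u v. (u, v) \<in> arcs_ends G \<longrightarrow> (v, u) \<notin> arcs_ends G)"
proof (cases "digraph G")
  case True
  then interpret digraph G .
  have "(\<exists>p. cycle p \<and> length p = 2) \<longleftrightarrow>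
        (\<exists>u v. (u, v) \<in> arcs_ends G \<and> (v, u) \<in> arcs_ends G)" (is "?L \<longleftrightarrow> ?R")
  proof
    assume ?L
    then obtain p u where p: "awalk u p u" "length p = 2" by (auto simp: cycle_def)
    then obtain e f where "p = [e, f]" by (auto simp: length_Suc_conv numeral_2_eq_2)
    with p show ?R
      by (auto simp: awalk_def arcs_ends_conv image_iff)
  next
    assume ?R
    then obtain e f where ef: "e \<in> arcs G" "f \<in> arcs G"
      "tail G f = head G e" "head G f = tail G e"
      by (auto simp: arcs_ends_conv)
    then have "awalk (tail G e) [e, f] (tail G e)"
      by (auto simp: awalk_def)
    moreover have "distinct (tl (awalk_verts (tail G e) [e, f]))"
      using ef no_loops[of e] by auto
    ultimately have "cycle [e, f]" by (auto simp: cycle_def)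
    then show ?L by (intro exI[of _ "[e, f]"]) simp
  qed
  then show ?thesis
    using True by (auto simp: oriented_graph_def oriented_graph_axioms_def)
qed (simp add: oriented_graph_def)

end

theory Submission
  imports Defs
begin

text \<open>
  Restrict to a terminal strong component. Among the longest paths choose one that closes up to a
  cycle \<open>C\<close> after an initial segment with as few vertices as possible. Every vertex at which some
  longest path with this initial segment can end has all its out-neighbours in \<open>C\<close>, and the
  predecessors on \<open>C\<close> of the out-neighbours of the vertex \<open>x\<close> before \<open>C\<close> are such ends. So, if the
  longest path has length \<open>l\<close>, the set \<open>A\<close> of all ends induces a digraph of minimum out-degree
  \<open>k \<ge> 2\<delta> - l\<close>, and \<open>|A| - k \<le> l - \<delta>\<close>. As \<open>2k < |A|\<close> in an oriented graph, this gives the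
  constant \<open>1.5\<close>.

  For girth at least 4, Shen's counting argument for directed triangles bounds the number of arcs
  in \<open>A\<close>, so almost all arcs from \<open>A\<close> to \<open>C - A\<close> are present. On the other hand, a vertex following one of
  \<open>C - A\<close> on \<open>C\<close> misses about \<open>2\<delta> - l\<close> arcs from \<open>A\<close>, since such an arc would let us
  reroute a longest path so that it ends in \<open>C - A\<close>. The missing arcs force \<open>C\<close> to pass often from
  \<open>C - A\<close> to \<open>A\<close>, and absence of triangles makes every such passage cost further arcs from \<open>A\<close> to
  \<open>C - A\<close>. The two counts are incompatible if \<open>l < 1.6535 \<delta>\<close>.
\<close>

section \<open>Arcs in triangle-free digraphs\<close>

text \<open>The arcs, their reversals and the diagonal are pairwise disjoint subsets of
  \<open>A \<times> A\<close>.\<close>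

lemma card_antisym_arcs:
  assumes "finite A" "\<And>u v. E u v \<Longrightarrow> \<not> E v u"
  shows "2 * card {(u, v). u \<in> A \<and> v \<in> A \<and> E u v} + card A \<le> card A * card A"
proof -
  let ?P = "{(u, v). u \<in> A \<and> v \<in> A \<and> E u v}"
  have fin: "finite ?P" by (rule finite_subset[of _ "A \<times> A"]) (use assms in auto)
  have irr: "\<not> E u u" for u using assms(2) by blast
  have "card (?P \<union> prod.swap ` ?P \<union> (\<lambda>u. (u, u)) ` A) = card ?P + card (prod.swap ` ?P) + card ((\<lambda>u. (u, u)) ` A)"
    using fin assms irr by (subst card_Un_disjoint, force, force, force)+ auto
  also have "\<dots> = 2 * card ?P + card A"
    by (simp add: card_image inj_on_def)
  finally have "2 * card ?P + card A = card (?P \<union> prod.swap ` ?P \<union> (\<lambda>u. (u, u)) ` A)" ..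
  also have "\<dots> \<le> card (A \<times> A)"
    by (rule card_mono) (use assms in auto)
  finally show ?thesis by (simp add: card_cartesian_product)
qed

text \<open>A bare relation on a finite set, so that induced subdigraphs are plain
  instances.\<close>

locale digraph_on =
  fixes V :: "'a set" and E :: "'a \<Rightarrow> 'a \<Rightarrow> bool"
  assumes finite_V: "finite V"
    and arc_in_V: "E u v \<Longrightarrow> u \<in> V \<and> v \<in> V"
begin

lemma finite_nbrs [simp]:
  "finite {x. E a x}" "finite {x. E x a}" "finite {x. E a x \<and> P x}" "finite {x. E x a \<and> P x}"
  by (rule finite_subset[OF _ finite_V]; use arc_in_V in auto)+

lemma finite_arcs [simp]: "finite {(u, v). E u v}"
  by (rule finite_subset[of _ "V \<times> V"]) (use finite_V arc_in_V in auto)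

lemma sum_arcs:
  fixes g :: "'a \<Rightarrow> 'a \<Rightarrow> real"
  shows sum_arcs_tail: "(\<Sum>(u, v) \<in> {(u, v). E u v}. g u v) = (\<Sum>u\<in>V. \<Sum>v\<in>{v. E u v}. g u v)"
    and sum_arcs_head: "(\<Sum>(u, v) \<in> {(u, v). E u v}. g u v) = (\<Sum>v\<in>V. \<Sum>u\<in>{u. E u v}. g u v)"
proof -
  have "{(u, v). E u v} = Sigma V (\<lambda>u. {v. E u v})" using arc_in_V by auto
  then show "(\<Sum>(u, v) \<in> {(u, v). E u v}. g u v) = (\<Sum>u\<in>V. \<Sum>v\<in>{v. E u v}. g u v)"
    using finite_V by (simp add: sum.Sigma)
  have "(\<Sum>(u, v) \<in> {(u, v). E u v}. g u v) = (\<Sum>(v, u) \<in> Sigma V (\<lambda>v. {u. E u v}). g u v)"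
    by (rule sum.reindex_bij_witness[of _ prod.swap prod.swap]) (use arc_in_V in auto)
  then show "(\<Sum>(u, v) \<in> {(u, v). E u v}. g u v) = (\<Sum>v\<in>V. \<Sum>u\<in>{u. E u v}. g u v)"
    using finite_V by (simp add: sum.Sigma)
qed

lemma card_arcs: "real (card {(u, v). E u v}) = (\<Sum>u\<in>V. real (card {v. E u v}))"
  using sum_arcs_tail[of "\<lambda>_ _. 1"] by simp

lemma card_arcs_ge:
  assumes "\<And>v. v \<in> V \<Longrightarrow> k \<le> real (card {w. E v w})"
  shows "k * card V \<le> card {(u, v). E u v}"
proof -
  have "(\<Sum>u\<in>V. k) \<le> (\<Sum>u\<in>V. real (card {w. E u w}))" using assms by (intro sum_mono) auto
  then show ?thesis by (simp add: card_arcs mult.commute)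
qed

text \<open>
  In- and out-neighbourhoods of an arc's ends are disjoint as there are no triangles. If \<open>u\<close> and \<open>v\<close>
  have common out-neighbours, the out-neighbourhood of \<open>v\<close> is enlarged by that of a common
  out-neighbour \<open>w\<close> that has few out-neighbours among the common ones.
\<close>

lemma shen_arc_inequality:
  fixes \<alpha> k :: real
  assumes E2: "\<And>u v. E u v \<Longrightarrow> \<not> E v u"
    and E3: "\<And>u v w. E u v \<Longrightarrow> E v w \<Longrightarrow> \<not> E w u"
    and k: "\<And>v. v \<in> V \<Longrightarrow> k \<le> card {w. E v w}"
    and \<alpha>: "\<And>N. N \<subseteq> V \<Longrightarrow> N \<noteq> {} \<Longrightarrow> \<exists>w\<in>N. card {x \<in> N. E w x} \<le> \<alpha> * card N"
    and uv: "E u v"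
  shows "1 + card {x. E x v} + (card {x. E x u} - real (card {x. E x u \<and> E x v}))
     + k + (1 - \<alpha>) * card {x. E u x \<and> E v x} \<le> card V"
proof -
  note V = finite_V arc_in_V
  note fin = finite_nbrs
  have ins: "card {x. E x v} + (card {x. E x u} - real (card {x. E x u \<and> E x v}))
      = card ({x. E x v} \<union> {x. E x u})"
  proof -
    have "card {x. E x v} + card {x. E x u} = card ({x. E x v} \<union> {x. E x u}) + card ({x. E x v} \<inter> {x. E x u})"
      by (rule card_Un_Int) (use fin in auto)
    moreover have "{x. E x v} \<inter> {x. E x u} = {x. E x u \<and> E x v}" by auto
    ultimately show ?thesis by simp
  qed
  \<comment> \<open>\<open>v\<close>, the in-neighbours of \<open>u\<close> or \<open>v\<close>, and
    \<open>X\<close> are disjoint. Below, \<open>X\<close> consists of the out-neighbours of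
    \<open>v\<close> and, in the second case, also those of \<open>w\<close>.\<close>
  have main: "1 + card ({x. E x v} \<union> {x. E x u}) + card X \<le> card V"
    if "X \<subseteq> V" "X \<inter> ({x. E x v} \<union> {x. E x u}) = {}" "v \<notin> X" for X
  proof -
    have fX: "finite X" using that V(1) finite_subset by blast
    have nv: "v \<notin> {x. E x v} \<union> {x. E x u}" using E2 uv by auto
    have "1 + card ({x. E x v} \<union> {x. E x u}) + card X = card ({v} \<union> ({x. E x v} \<union> {x. E x u}) \<union> X)"
      using fin fX that nv by (subst card_Un_disjoint, force, force, force)+ auto
    also have "\<dots> \<le> card V" using that V uv by (intro card_mono) auto
    finally show ?thesis .
  qed
  define N where "N = {x. E u x \<and> E v x}"
  show ?thesis
  proof (cases "N = {}")
    case True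
    have "real (1 + card ({x. E x v} \<union> {x. E x u}) + card {x. E v x}) \<le> real (card V)"
      by (rule of_nat_mono, rule main) (use V uv E2 E3 in blast)+
    moreover have "k \<le> card {x. E v x}" using k V uv by blast
    moreover have "card {x. E u x \<and> E v x} = 0" using True unfolding N_def by (simp only: card.empty)
    ultimately show ?thesis using ins by (simp only: of_nat_add)
  next
    case False
    have NV: "N \<subseteq> V" using V unfolding N_def by auto
    obtain w where w: "w \<in> N" "card {x \<in> N. E w x} \<le> \<alpha> * card N" using \<alpha>[OF NV False] by blast
    have uw: "E u w" "E v w" using w(1) unfolding N_def by auto
    have 1: "1 + card ({x. E x v} \<union> {x. E x u}) + card ({x. E v x} \<union> {x. E w x}) \<le> card V"
      by (rule main) (use V uv uw E2 E3 in blast)+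
    have 2: "card {x. E v x} + card {x. E w x} = card ({x. E v x} \<union> {x. E w x}) + card ({x. E v x} \<inter> {x. E w x})"
      by (rule card_Un_Int) (use fin in auto)
    \<comment> \<open>A common out-neighbour of \<open>v\<close> and \<open>w\<close> lies in
      \<open>N\<close>, where \<open>w\<close> has few out-neighbours, or in the rest of the
      out-neighbourhood of \<open>v\<close>.\<close>
    have "card ({x. E v x} \<inter> {x. E w x}) \<le> card ({x \<in> N. E w x} \<union> ({x. E v x} - N))"
      by (rule card_mono) (use fin in \<open>auto simp: N_def\<close>)
    also have "\<dots> \<le> card {x \<in> N. E w x} + card ({x. E v x} - N)" by (rule card_Un_le)
    finally have 3: "card ({x. E v x} \<inter> {x. E w x}) \<le> card {x \<in> N. E w x} + card ({x. E v x} - N)" .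
    have 4: "card ({x. E v x} - N) + card N = card {x. E v x}"
    proof -
      have "N \<subseteq> {x. E v x}" unfolding N_def by auto
      then show ?thesis using fin(1)[of v] by (metis card_Diff_subset card_mono finite_subset le_add_diff_inverse2)
    qed
    have 5: "k \<le> card {x. E w x}" using k V uw by blast
    have "k + (1 - \<alpha>) * card N \<le> card ({x. E v x} \<union> {x. E w x})"
      using 2 3 4 5 w(2) by (simp add: algebra_simps)
    with 1 ins show ?thesis unfolding N_def by simp
  qed
qed

text \<open>Sum the arc inequality over all arcs. Each transitive triangle is counted once by
  \<open>tr\<close> and once by \<open>tr'\<close>, so both sums equal \<open>T\<close>; then
  \<open>T \<le> D / 2\<close>, and Cauchy-Schwarz eliminates \<open>D\<close>.\<close>

lemma shen_inequality:
  fixes \<alpha> k :: real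
  assumes E2: "\<And>u v. E u v \<Longrightarrow> \<not> E v u"
    and E3: "\<And>u v w. E u v \<Longrightarrow> E v w \<Longrightarrow> \<not> E w u"
    and k: "\<And>v. v \<in> V \<Longrightarrow> k \<le> card {w. E v w}"
    and \<alpha>: "\<And>N. N \<subseteq> V \<Longrightarrow> N \<noteq> {} \<Longrightarrow> \<exists>w\<in>N. card {x \<in> N. E w x} \<le> \<alpha> * card N"
    and \<alpha>01: "0 \<le> \<alpha>" "\<alpha> \<le> 1"
    and m: "m = card {(u, v). E u v}" "m > 0"
  shows "(1 - \<alpha> / 2) * m \<le> real (card V) * (real (card V) - 1 - 2 * k)"
proof -
  define n where "n = real (card V)"
  define ind where "ind v = real (card {u. E u v})" for v
  define outd where "outd v = real (card {w. E v w})" for v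
  define tr where "tr u v = real (card {x. E u x \<and> E v x})" for u v
  define tr' where "tr' u v = real (card {x. E x u \<and> E x v})" for u v
  let ?A = "{(u, v). E u v}"
  note finA = finite_arcs
  note V = finite_V arc_in_V
  note fin = finite_nbrs
  define D where "D = (\<Sum>v\<in>V. ind v * ind v)"
  have sD: "(\<Sum>(u, v)\<in>?A. ind v) = D"
    unfolding D_def by (subst sum_arcs_head) (auto simp: ind_def)
  have sI: "(\<Sum>v\<in>V. ind v) = m"
    using sum_arcs_head[of "\<lambda>_ _. 1"] m by (simp add: ind_def)
  have sP: "k * m \<le> (\<Sum>(u, v)\<in>?A. ind u)"
  proof -
    have "(\<Sum>(u, v)\<in>?A. ind u) = (\<Sum>u\<in>V. outd u * ind u)"
      by (subst sum_arcs_tail) (auto simp: outd_def)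
    also have "\<dots> \<ge> (\<Sum>u\<in>V. k * ind u)"
      by (intro sum_mono mult_right_mono) (use k in \<open>auto simp: outd_def ind_def\<close>)
    finally show ?thesis using sI by (simp add: sum_distrib_left[symmetric])
  qed
  define T where "T = (\<Sum>(u, v)\<in>?A. tr u v)"
  have T': "(\<Sum>(u, v)\<in>?A. tr' u v) = T"
  proof -
    have "(\<Sum>(u, v)\<in>?A. tr' u v) = real (card (Sigma ?A (\<lambda>(u, v). {x. E x u \<and> E x v})))"
      using finA fin by (subst card_SigmaI) (auto simp: tr'_def case_prod_unfold)
    also have "card (Sigma ?A (\<lambda>(u, v). {x. E x u \<and> E x v})) = card (Sigma ?A (\<lambda>(u, v). {x. E u x \<and> E v x}))"
      by (rule bij_betw_same_card[of "\<lambda>((u, v), x). ((x, u), v)"],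
          rule bij_betw_byWitness[where f' = "\<lambda>((u, v), x). ((v, x), u)"]) auto
    also have "real \<dots> = T" unfolding T_def
      using finA fin by (subst card_SigmaI) (auto simp: tr_def case_prod_unfold)
    finally show ?thesis .
  qed
  have TD: "T \<le> D / 2"
  proof -
    have "T = real (card (Sigma ?A (\<lambda>(u, v). {x. E u x \<and> E v x})))" unfolding T_def
      using finA fin by (subst card_SigmaI) (auto simp: tr_def case_prod_unfold)
    \<comment> \<open>Transitive triangles are grouped by their sink \<open>x\<close>; the remaining
      arc lies inside the in-neighbourhood of \<open>x\<close>.\<close>
    also have "card (Sigma ?A (\<lambda>(u, v). {x. E u x \<and> E v x}))
        = card (Sigma V (\<lambda>x. {(u, v). u \<in> {u. E u x} \<and> v \<in> {u. E u x} \<and> E u v}))"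
      by (rule bij_betw_same_card[of "\<lambda>((u, v), x). (x, (u, v))"],
          rule bij_betw_byWitness[where f' = "\<lambda>(x, (u, v)). ((u, v), x)"]) (use V in auto)
    also have "real \<dots> = (\<Sum>x\<in>V. real (card {(u, v). u \<in> {u. E u x} \<and> v \<in> {u. E u x} \<and> E u v}))"
      using V(1) by (subst card_SigmaI) (auto intro: finite_subset[OF _ finA])
    also have "\<dots> \<le> (\<Sum>x\<in>V. ind x * ind x / 2)"
    proof (rule sum_mono)
      fix x
      from card_antisym_arcs[of "{u. E u x}" E] fin E2
      have "2 * card {(u, v). u \<in> {u. E u x} \<and> v \<in> {u. E u x} \<and> E u v} \<le> card {u. E u x} * card {u. E u x}" by fastforce
      then have "real (2 * card {(u, v). u \<in> {u. E u x} \<and> v \<in> {u. E u x} \<and> E u v}) \<le> real (card {u. E u x} * card {u. E u x})"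
        by (simp only: of_nat_le_iff)
      then show "real (card {(u, v). u \<in> {u. E u x} \<and> v \<in> {u. E u x} \<and> E u v}) \<le> ind x * ind x / 2"
        unfolding ind_def by simp
    qed
    finally show ?thesis by (simp add: D_def sum_divide_distrib)
  qed
  have "(\<Sum>(u, v)\<in>?A. 1 + ind v + (ind u - tr' u v) + k + (1 - \<alpha>) * tr u v) \<le> (\<Sum>(u, v)\<in>?A. n)"
    using shen_arc_inequality[OF E2 E3 k \<alpha>]
    by (intro sum_mono) (auto simp: ind_def tr_def tr'_def n_def)
  also have "\<dots> = n * m" using m by (simp add: case_prod_unfold)
  finally have "m + D + ((\<Sum>(u, v)\<in>?A. ind u) - T) + k * m + (1 - \<alpha>) * T \<le> n * m"
    using m sD T' by (simp add: case_prod_unfold sum.distrib sum_subtractf sum_distrib_left[symmetric] T_def mult.commute)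
  with sP have "m + D + 2 * k * m - \<alpha> * T \<le> n * m" by (simp add: algebra_simps)
  moreover have "\<alpha> * T \<le> \<alpha> * (D / 2)" using mult_left_mono[OF TD \<alpha>01(1)] .
  ultimately have 1: "m + (1 - \<alpha> / 2) * D + 2 * k * m \<le> n * m" by (simp add: algebra_simps)
  have CS: "real m * m \<le> n * D"
  proof -
    \<comment> \<open>Cauchy-Schwarz, from the squared deviations of the in-degrees from their
      mean.\<close>
    have "0 \<le> (\<Sum>v\<in>V. (n * ind v - m)\<^sup>2)" by (simp add: sum_nonneg)
    also have "\<dots> = (\<Sum>v\<in>V. n * n * (ind v * ind v) - 2 * n * m * ind v + real m * m)"
      by (intro sum.cong refl) (simp add: power2_eq_square algebra_simps)
    also have "\<dots> = n * n * D - 2 * n * m * (\<Sum>v\<in>V. ind v) + n * (real m * m)"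
      unfolding D_def sum.distrib sum_subtractf sum_distrib_left by (simp add: n_def)
    also have "\<dots> = n * (n * D - real m * m)" using sI by (simp add: algebra_simps)
    finally have "0 \<le> n * (n * D - real m * m)" .
    moreover have "n > 0" using sI m(2) finite_V unfolding n_def by (auto simp: card_gt_0_iff)
    ultimately show ?thesis by (simp add: zero_le_mult_iff)
  qed
  have "(1 - \<alpha> / 2) * (real m * m) \<le> (1 - \<alpha> / 2) * (n * D)" using CS \<alpha>01 by (intro mult_left_mono) auto
  also have "\<dots> = n * ((1 - \<alpha> / 2) * D)" by simp
  also have "\<dots> \<le> n * (n * m - m - 2 * k * m)" using 1 by (intro mult_left_mono) (auto simp: n_def)
  also have "\<dots> = (n * (n - 1 - 2 * k)) * m" by (simp add: algebra_simps)
  finally have "((1 - \<alpha> / 2) * m) * m \<le> (n * (n - 1 - 2 * k)) * m" by (simp add: mult.assoc)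
  then show ?thesis using m(2) unfolding n_def by simp
qed

text \<open>
  The constant comes from applying Shen's inequality twice: \<open>\<alpha> = 1/2\<close> is trivial and yields
  \<open>\<alpha> = 4/11\<close>, which in turn yields the bound below.
\<close>

lemma arc_density_le:
  fixes k :: real
  assumes "V \<noteq> {}"
    and E2: "\<And>u v. E u v \<Longrightarrow> \<not> E v u"
    and E3: "\<And>u v w. E u v \<Longrightarrow> E v w \<Longrightarrow> \<not> E w u"
    and k: "\<And>v. v \<in> V \<Longrightarrow> k \<le> card {w. E v w}" "k > 0"
  shows "9 * real (card {(u, v). E u v}) \<le> 11 * (real (card V) * (real (card V) - 1 - 2 * k))"
proof -
  note V = finite_V \<open>V \<noteq> {}\<close> arc_in_V
  have half: "\<exists>w\<in>N. card {x \<in> N. E w x} \<le> 1 / 2 * real (card N)" if N: "N \<subseteq> V" "N \<noteq> {}" for N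
  proof (rule ccontr)
    assume c: "\<not> ?thesis"
    let ?F = "\<lambda>u v. u \<in> N \<and> v \<in> N \<and> E u v"
    have f: "finite N" using N V finite_subset by blast
    interpret N: digraph_on N ?F by unfold_locales (use f in auto)
    have n0: "card N > 0" using N f by (simp add: card_gt_0_iff)
    have "\<exists>v\<in>N. real (card {w. ?F v w}) < (real (card N) + 1) / 2"
    proof (rule ccontr)
      assume "\<not> ?thesis"
      then have "(real (card N) + 1) / 2 * card N \<le> card {(u, v). ?F u v}"
        by (intro N.card_arcs_ge) (simp add: not_less)
      then have "real (card N) * real (card N) + real (card N) \<le> 2 * real (card {(u, v). ?F u v})"
        by (simp add: algebra_simps)
      moreover have "real (2 * card {(u, v). ?F u v} + card N) \<le> real (card N * card N)"
        using card_antisym_arcs[of N E, OF f E2] by (simp only: of_nat_le_iff)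
      ultimately show False using n0 by simp
    qed
    then obtain v where v: "v \<in> N" "real (card {w. ?F v w}) < (card N + 1) / 2" by auto
    have "real (card {x \<in> N. E v x}) \<le> 1 / 2 * card N"
    proof -
      have "{w. ?F v w} = {x \<in> N. E v x}" using v by auto
      then have "real (2 * card {x \<in> N. E v x}) < real (card N + 1)" using v(2) by simp
      then have "2 * card {x \<in> N. E v x} \<le> card N" by (simp only: of_nat_less_iff)
      then show ?thesis by linarith
    qed
    with c v show False by blast
  qed
  have better: "\<exists>w\<in>N. card {x \<in> N. E w x} \<le> 4 / 11 * real (card N)" if N: "N \<subseteq> V" "N \<noteq> {}" for N
  proof (rule ccontr)
    assume c: "\<not> ?thesis"
    let ?F = "\<lambda>u v. u \<in> N \<and> v \<in> N \<and> E u v"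
    have f: "finite N" using N V finite_subset by blast
    interpret N: digraph_on N ?F by unfold_locales (use f in auto)
    have e: "{w. ?F v w} = {x \<in> N. E v x}" if "v \<in> N" for v using that by auto
    \<comment> \<open>With \<open>\<alpha> = 1/2\<close> and at least \<open>k * card N\<close>
      arcs, Shen's inequality gives \<open>11/4 * k \<le> card N - 1\<close>, which excludes this
      value.\<close>
    define k where "k = 4 / 11 * real (card N)"
    have kk: "k \<le> card {w. ?F v w}" if "v \<in> N" for v
      using c that e[OF that] unfolding k_def by force
    have m: "k * card N \<le> card {(u, v). ?F u v}"
      by (rule N.card_arcs_ge) (use kk in auto)
    have n0: "card N > 0" using N f by (simp add: card_gt_0_iff)
    then have "0 < k * card N" unfolding k_def by simp
    then have mp: "card {(u, v). ?F u v} > 0" using m by linarith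
    have "(1 - (1 / 2) / 2) * real (card {(u, v). ?F u v}) \<le> real (card N) * (real (card N) - 1 - 2 * k)"
    proof (rule N.shen_inequality)
      fix M assume M: "M \<subseteq> N" "M \<noteq> {}"
      then obtain w where "w \<in> M" "card {x \<in> M. E w x} \<le> 1 / 2 * real (card M)" using half[of M] N by blast
      moreover have "{x \<in> M. ?F w x} = {x \<in> M. E w x}" using M \<open>w \<in> M\<close> by auto
      ultimately show "\<exists>w\<in>M. card {x \<in> M. ?F w x} \<le> 1 / 2 * real (card M)" by metis
    next
      show "\<And>u v. ?F u v \<Longrightarrow> \<not> ?F v u" using E2 by blast
      show "\<And>u v w. ?F u v \<Longrightarrow> ?F v w \<Longrightarrow> \<not> ?F w u" using E3 by blast
    qed (use kk mp in simp_all)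
    then have "(1 - (1 / 2) / 2) * (k * card N) \<le> real (card N) * (real (card N) - 1 - 2 * k)"
      by (rule order_trans[rotated], intro mult_left_mono m) simp
    then have "real (card N) * (3 / 4 * k) \<le> real (card N) * (real (card N) - 1 - 2 * k)" by (simp add: algebra_simps)
    then have "3 / 4 * k \<le> real (card N) - 1 - 2 * k" using n0 by simp
    then show False unfolding k_def by simp
  qed
  have "k * card V \<le> card {(u, v). E u v}" by (rule card_arcs_ge) (use k in auto)
  moreover have "0 < k * card V" using V k by (simp add: card_gt_0_iff)
  ultimately have mp: "card {(u, v). E u v} > 0" by linarith
  have "(1 - (4 / 11) / 2) * real (card {(u, v). E u v}) \<le> real (card V) * (real (card V) - 1 - 2 * k)"
  proof (rule shen_inequality[OF E2 E3 k(1) better])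
  qed (use mp in simp_all)
  then show ?thesis by simp
qed

end

section \<open>Rotating longest paths\<close>

text \<open>
  Here \<open>ys\<close> is the cycle \<open>C\<close> and \<open>x\<close> the vertex preceding it on the longest path; the rest of the
  initial segment only enters through the assumption \<open>closed\<close>.
\<close>

locale rotation = digraph_on +
  fixes x :: 'a and ys :: "'a list" and \<delta> :: nat
  assumes cyc: "ys \<noteq> []" "distinct ys" "successively E ys" "E (last ys) (hd ys)"
    and deg: "v \<in> V \<Longrightarrow> \<delta> \<le> card {w. E v w}"
    and antisym: "E u v \<Longrightarrow> \<not> E v u"
    and closed: "distinct zs \<Longrightarrow> set zs = set ys \<Longrightarrow> successively E zs \<Longrightarrow> E x (hd zs)
      \<Longrightarrow> E (last zs) w \<Longrightarrow> w \<in> set ys"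
    and entry: "\<exists>y\<in>set ys. E x y"
begin

section \<open>The cycle, its successor function and the ends\<close>

abbreviation C :: "'a set" where "C \<equiv> set ys"

text \<open>Each such \<open>zs\<close> can replace \<open>ys\<close> behind the initial segment and
  again gives a longest path; collected are the last vertices.\<close>

definition ends :: "'a set" where
  "ends = {last zs | zs. distinct zs \<and> set zs = C \<and> successively E zs \<and> E x (hd zs)}"

text \<open>The successor on the cycle as a function of the vertex, so that shifting a set along the
  cycle is an injective image.\<close>

definition nxt :: "'a \<Rightarrow> 'a" where
  "nxt v = ys ! (Suc (THE i. i < length ys \<and> ys ! i = v) mod length ys)"

text \<open>The path once round the cycle from \<open>nxt s\<close> ends at
  \<open>s\<close>.\<close>

definition starts :: "'a set" where "starts = {s \<in> C. E x (nxt s)}"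

lemma nxt_nth: "i < length ys \<Longrightarrow> nxt (ys ! i) = ys ! (Suc i mod length ys)"
proof -
  assume i: "i < length ys"
  then have "(THE i'. i' < length ys \<and> ys ! i' = ys ! i) = i"
    using cyc(2) by (intro the_equality) (auto simp: nth_eq_iff_index_eq)
  then show ?thesis by (simp add: nxt_def)
qed

lemma nxt_arc:
  assumes "v \<in> C" shows "E v (nxt v)" "nxt v \<in> C"
proof -
  obtain i where i: "i < length ys" "v = ys ! i" using assms by (auto simp: in_set_conv_nth)
  show "nxt v \<in> C" using i cyc(1) by (simp add: nxt_nth)
  show "E v (nxt v)"
  proof (cases "Suc i < length ys")
    case True
    then show ?thesis using i cyc(3) by (simp add: nxt_nth successively_nth)
  next
    case False
    then have "Suc i = length ys" using i by simp
    then have "v = last ys" "nxt v = hd ys"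
      using i cyc(1) by (simp_all add: nxt_nth last_conv_nth hd_conv_nth flip: \<open>Suc i = length ys\<close>)
    then show ?thesis using cyc(4) by simp
  qed
qed

lemma nxt_image: "nxt ` C = C"
proof
  show "nxt ` C \<subseteq> C" using nxt_arc by auto
  show "C \<subseteq> nxt ` C"
  proof
    fix v assume "v \<in> C"
    then obtain i where i: "i < length ys" "v = ys ! i" by (auto simp: in_set_conv_nth)
    show "v \<in> nxt ` C"
    proof (cases i)
      case 0
      then have "v = nxt (ys ! (length ys - 1))" using i by (simp add: nxt_nth)
      moreover have "ys ! (length ys - 1) \<in> C" using i by simp
      ultimately show ?thesis by blast
    next
      case (Suc j)
      then have "v = nxt (ys ! j)" using i by (simp add: nxt_nth)
      moreover have "ys ! j \<in> C" using i Suc by simp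
      ultimately show ?thesis by blast
    qed
  qed
qed

lemma nxt_inj: "inj_on nxt C"
  by (rule eq_card_imp_inj_on) (simp_all add: nxt_image)

text \<open>Cuts the cycle open before \<open>w\<close>, so that vertices can be compared by their
  position in a list.\<close>

lemma rotation_from:
  assumes "w \<in> C"
  obtains vs where "distinct vs" "set vs = C" "successively E vs" "hd vs = w"
    "\<And>j. Suc j < length vs \<Longrightarrow> nxt (vs ! j) = vs ! Suc j" "nxt (last vs) = w"
proof -
  obtain i where i: "i < length ys" "w = ys ! i" using assms by (auto simp: in_set_conv_nth)
  define vs where "vs = rotate i ys"
  have len: "length vs = length ys" by (simp add: vs_def)
  have step: "nxt (vs ! j) = vs ! (Suc j mod length vs)" if "j < length vs" for j
  proof -
    have "(i + j) mod length ys < length ys" using cyc(1) by simp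
    then have "nxt (vs ! j) = ys ! (Suc ((i + j) mod length ys) mod length ys)"
      using that by (simp add: vs_def nth_rotate nxt_nth)
    also have "\<dots> = vs ! (Suc j mod length vs)"
      using cyc(1) by (simp add: vs_def nth_rotate mod_simps)
    finally show ?thesis .
  qed
  have w0: "vs ! 0 = w" using i nth_rotate[of 0 ys i] cyc(1) by (simp add: vs_def)
  show thesis
  proof
    show "distinct vs" "set vs = C" using cyc(2) by (simp_all add: vs_def)
    show "nxt (vs ! j) = vs ! Suc j" if "Suc j < length vs" for j
      using step[of j] that by simp
    then show "successively E vs"
      unfolding successively_conv_nth using nxt_arc(1) \<open>set vs = C\<close> by (metis Suc_lessD nth_mem)
    have ne: "vs \<noteq> []" using cyc(1) len by auto
    then show "hd vs = w" using w0 by (simp add: hd_conv_nth)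
    show "nxt (last vs) = w"
      using ne step[of "length vs - 1"] w0 by (simp add: last_conv_nth)
  qed
qed

lemma starts_subset_ends: "starts \<subseteq> ends"
proof
  fix s assume s: "s \<in> starts"
  then have sC: "s \<in> C" "E x (nxt s)" by (auto simp: starts_def)
  obtain vs where vs: "distinct vs" "set vs = C" "successively E vs" "hd vs = nxt s" "nxt (last vs) = nxt s"
    using rotation_from[OF nxt_arc(2)[OF sC(1)]] by metis
  then have "last vs \<in> C" using cyc(1) by (metis last_in_set set_empty)
  then have "last vs = s" using vs(5) nxt_inj sC by (auto dest: inj_onD)
  then show "s \<in> ends" unfolding ends_def using vs sC by (metis (mono_tags, lifting) mem_Collect_eq)
qed

lemma ends_subset: "ends \<subseteq> C"
proof
  fix e assume "e \<in> ends"
  then obtain zs where zs: "e = last zs" "set zs = C" unfolding ends_def by blast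
  then have "zs \<noteq> []" using cyc(1) by force
  then show "e \<in> C" using zs last_in_set by metis
qed

lemma ends_closed: "e \<in> ends \<Longrightarrow> E e w \<Longrightarrow> w \<in> C"
  unfolding ends_def using closed by blast

lemma finite_ends [simp]: "finite ends"
  using ends_subset finite_subset by blast

lemma card_starts: "card starts = card {y \<in> C. E x y}"
proof -
  have "{y \<in> C. E x y} = nxt ` starts" unfolding starts_def using nxt_image by auto
  moreover have "inj_on nxt starts" using nxt_inj unfolding starts_def by (rule inj_on_subset) auto
  ultimately show ?thesis by (simp add: card_image)
qed

lemma starts_nonempty: "starts \<noteq> {}"
  using entry nxt_image unfolding starts_def by force

lemma in_V: "v \<in> C \<Longrightarrow> v \<in> V"
  using nxt_arc arc_in_V by blast

text \<open>Moving \<open>bs\<close> to the front keeps the vertices and the last one; the three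
  extra arcs enter \<open>bs\<close>, lead from it to \<open>as\<close>, and bridge the gap it
  leaves.\<close>

lemma rotated_end:
  assumes "distinct (as @ bs @ ds)" "set (as @ bs @ ds) = C" "successively E (as @ bs @ ds)"
    and "as \<noteq> []" "bs \<noteq> []" "ds \<noteq> []"
    and "E x (hd bs)" "E (last bs) (hd as)" "E (last as) (hd ds)"
  shows "last ds \<in> ends"
proof -
  have "distinct (bs @ as @ ds)" "set (bs @ as @ ds) = C" "last (bs @ as @ ds) = last ds"
    "hd (bs @ as @ ds) = hd bs" using assms by auto
  moreover have "successively E (bs @ as @ ds)"
    using assms by (auto simp: successively_append_iff)
  ultimately show ?thesis unfolding ends_def using assms(7)
    by (metis (mono_tags, lifting) mem_Collect_eq)
qed

text \<open>
  Going round \<open>C\<close> from \<open>w = nxt p\<close>, let \<open>s\<close> be the first vertex in \<open>starts\<close>. If \<open>s \<rightarrow> nxt z\<close> and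
  \<open>z \<rightarrow> w\<close> with \<open>z\<close> after \<open>s\<close>, then \<open>nxt s, \<dots>, z, w, \<dots>, s, nxt z, \<dots>, p\<close> would show that
  \<open>p\<close> is an end.
\<close>

lemma non_in_neighbours:
  assumes p: "p \<in> C" "p \<notin> ends"
  shows "\<delta> \<le> card {z \<in> ends. \<not> E z (nxt p)} + card (ends - starts) + 1 + card (C - ends)"
proof -
  define w where "w = nxt p"
  have "w \<in> C" using nxt_arc(2)[OF p(1)] by (simp add: w_def)
  then obtain vs where vs: "distinct vs" "set vs = C" "successively E vs" "hd vs = w"
    "\<And>j. Suc j < length vs \<Longrightarrow> nxt (vs ! j) = vs ! Suc j" "nxt (last vs) = w"
    using rotation_from by metis
  have ne: "vs \<noteq> []" using vs(2) cyc(1) by auto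
  have lp: "last vs = p"
    using vs(2,6) ne nxt_inj p(1) unfolding w_def by (metis inj_onD last_in_set)
  have ex: "\<exists>i. i < length vs \<and> vs ! i \<in> starts"
    using starts_nonempty vs(2) unfolding starts_def by (metis (no_types, lifting) all_not_in_conv in_set_conv_nth mem_Collect_eq)
  define i where "i = (LEAST i. i < length vs \<and> vs ! i \<in> starts)"
  have i: "i < length vs" "vs ! i \<in> starts" using LeastI_ex[OF ex] unfolding i_def by auto
  have i_min: "vs ! j \<notin> starts" if "j < i" for j
    using not_less_Least[of j "\<lambda>i. i < length vs \<and> vs ! i \<in> starts"] that i(1)
    unfolding i_def[symmetric] by auto
  define s where "s = vs ! i"
  have s: "s \<in> C" "s \<in> ends" "E x (nxt s)"
    using i starts_subset_ends unfolding s_def starts_def by auto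
  have key: "z = s \<or> z \<notin> starts" if z: "z \<in> ends" "E s (nxt z)" "E z w" for z
  proof (rule ccontr)
    assume c: "\<not> ?thesis"
    obtain j where j: "j < length vs" "z = vs ! j"
      using z ends_subset vs(2) by (metis in_set_conv_nth subsetD)
    have ij: "i < j" using c i_min j unfolding s_def by (metis nat_neq_iff)
    \<comment> \<open>\<open>z\<close> is an end and the last vertex \<open>p\<close> is not, so
      \<open>ds\<close> below is nonempty.\<close>
    have "Suc j \<noteq> length vs"
      using lp j z(1) p(2) ne by (metis diff_Suc_1 last_conv_nth)
    then have Sj: "Suc j < length vs" using j by simp
    define as where "as = take (Suc i) vs"
    define bs where "bs = drop (Suc i) (take (Suc j) vs)"
    define ds where "ds = drop (Suc j) vs"
    note as_bs_ds_def = as_def bs_def ds_def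
    have dec: "vs = as @ bs @ ds"
    proof -
      have "as @ bs = take (Suc j) vs" unfolding as_bs_ds_def
        using ij by (metis append_take_drop_id less_imp_le_nat min.absorb1 not_less_eq_eq take_take Suc_le_mono)
      then show ?thesis unfolding as_bs_ds_def by (metis append.assoc append_take_drop_id)
    qed
    have ne3: "as \<noteq> []" "bs \<noteq> []" "ds \<noteq> []" using ij Sj ne unfolding as_bs_ds_def by auto
    have "hd bs = nxt s" "last bs = z" "hd ds = nxt z"
      unfolding as_bs_ds_def s_def using ij Sj j vs(5)[of i] vs(5)[of j]
      by (auto simp: hd_drop_conv_nth last_conv_nth)
    moreover have "last as = s"
      unfolding as_bs_ds_def s_def using i(1) by (simp add: take_Suc_conv_app_nth)
    moreover have "hd as = w" "last ds = p" using dec ne3 vs(4) lp by auto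
    ultimately have "last ds \<in> ends"
      by (intro rotated_end[of as bs]) (use vs dec ne3 z s in auto)
    with \<open>last ds = p\<close> p show False by simp
  qed
  \<comment> \<open>Every out-neighbour of \<open>s\<close> is \<open>nxt z\<close> for some
    \<open>z\<close> in \<open>C\<close>. By \<open>key\<close>, \<open>z\<close> is not an end, has
    no arc to \<open>w\<close>, is not in \<open>starts\<close>, or is \<open>s\<close> itself,
    whence the summand 1.\<close>
  have "\<delta> \<le> card {v. E s v}" using deg in_V s by auto
  also have "{v. E s v} = nxt ` {z \<in> C. E s (nxt z)}"
    using ends_closed[OF s(2)] nxt_image by auto
  also have "card \<dots> \<le> card {z \<in> C. E s (nxt z)}" by (rule card_image_le) simp
  also have "\<dots> \<le> card (({z \<in> ends. \<not> E z w} \<union> (ends - starts) \<union> {s}) \<union> (C - ends))"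
    by (rule card_mono) (use key in auto)
  also have "\<dots> \<le> card {z \<in> ends. \<not> E z w} + card (ends - starts) + card {s} + card (C - ends)"
    by (meson add_le_mono card_Un_le le_refl order_trans)
  finally show ?thesis unfolding w_def by simp
qed

section \<open>Counting arcs from the ends\<close>

lemma deg_ends:
  assumes "z \<in> ends"
  shows "\<delta> \<le> card {w \<in> ends. E z w} + card {w \<in> C - ends. E z w}"
proof -
  have "{w. E z w} = {w \<in> ends. E z w} \<union> {w \<in> C - ends. E z w}"
    using ends_closed[OF assms] ends_subset by auto
  then have "card {w. E z w} = card ({w \<in> ends. E z w} \<union> {w \<in> C - ends. E z w})"
    by (rule arg_cong)
  also have "\<dots> = card {w \<in> ends. E z w} + card {w \<in> C - ends. E z w}"
    by (rule card_Un_disjoint) auto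
  finally show ?thesis using deg[of z] in_V ends_subset assms by auto
qed

lemma ends_nonempty: "ends \<noteq> {}"
  using starts_nonempty starts_subset_ends by blast

lemma card_C: "card C = card ends + card (C - ends)"
  using ends_subset by (metis card_Diff_subset card_mono finite_ends le_add_diff_inverse List.finite_set)

abbreviation "ends_arc u v \<equiv> u \<in> ends \<and> v \<in> ends \<and> E u v"

sublocale ends: digraph_on ends ends_arc
  by unfold_locales auto

lemma ends_arc_card: "z \<in> ends \<Longrightarrow> card {w. ends_arc z w} = card {w \<in> ends. E z w}"
  by (rule arg_cong[of _ _ card]) auto

text \<open>All out-neighbours of an end lie in \<open>C\<close>. The bound is the \<open>k\<close>
  of the later counts.\<close>

lemma deg_ends':
  assumes "z \<in> ends"
  shows "real \<delta> - card (C - ends) \<le> card {w \<in> ends. E z w}"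
proof -
  have "card {w \<in> C - ends. E z w} \<le> card (C - ends)" by (rule card_mono) auto
  then show ?thesis using deg_ends[OF assms] by linarith
qed

lemma arcs_within_ends:
  "(real \<delta> - card (C - ends)) * card ends \<le> card {(u, v). ends_arc u v}"
  using ends.card_arcs_ge[of "real \<delta> - card (C - ends)"] deg_ends' ends_arc_card by simp

text \<open>\<open>a\<close> counts the vertices up to \<open>x\<close>, so
  \<open>a + card C - 1\<close> is the length of the longest path. By antisymmetry
  \<open>card ends\<close> exceeds twice the minimum out-degree inside \<open>ends\<close>; moreover
  \<open>ends\<close> contains \<open>starts\<close>, which has at least
  \<open>\<delta> + 1 - a\<close> elements.\<close>

lemma oriented_bound:
  assumes "a \<ge> 1" "card {y \<in> C. E x y} + a \<ge> \<delta> + 1"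
  shows "2 * (a + card C - 1) \<ge> 3 * \<delta> + 1"
proof -
  have n0: "card ends > 0" using ends_nonempty by (simp add: card_gt_0_iff)
  have "real (2 * card {(u, v). ends_arc u v} + card ends) \<le> real (card ends * card ends)"
    using card_antisym_arcs[of ends E, OF _ antisym] by (simp only: of_nat_le_iff finite_ends)
  then have "card ends * (2 * (real \<delta> - card (C - ends)) + 1) \<le> card ends * real (card ends)"
    using arcs_within_ends by (simp add: algebra_simps)
  then have "2 * (real \<delta> - card (C - ends)) + 1 \<le> card ends" using n0 by simp
  then have "real (2 * \<delta> + 1) \<le> real (card ends + 2 * card (C - ends))" by simp
  then have "2 * \<delta> + 1 \<le> card ends + 2 * card (C - ends)" by (simp only: of_nat_le_iff)
  moreover have "card {y \<in> C. E x y} \<le> card ends"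
    unfolding card_starts[symmetric] by (rule card_mono) (use starts_subset_ends in auto)
  ultimately show ?thesis using assms card_C by linarith
qed

lemma non_arcs_swap:
  "(\<Sum>z\<in>ends. real (card {y \<in> A. \<not> E z y})) = (\<Sum>y\<in>A. real (card {z \<in> ends. \<not> E z y}))"
  if "finite A" for A
proof -
  have "(\<Sum>z\<in>ends. card {y \<in> A. \<not> E z y}) = (\<Sum>y\<in>A. card {z \<in> ends. \<not> E z y})"
    using sum_multicount_gen[of ends A "\<lambda>z y. \<not> E z y"] that by (simp add: sum.swap)
  then show ?thesis by (simp flip: of_nat_sum)
qed

text \<open>An end with \<open>d\<close> out-neighbours among the ends has at least
  \<open>\<delta> - d\<close> in \<open>C - ends\<close>, which bounds the number it misses there;
  sum over the ends.\<close>

lemma non_arcs_leaving_ends: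
  "(\<Sum>y\<in>C - ends. real (card {z \<in> ends. \<not> E z y}))
     \<le> card {(u, v). ends_arc u v} - (real \<delta> - card (C - ends)) * card ends"
proof -
  have "(\<Sum>z\<in>ends. real (card {y \<in> C - ends. \<not> E z y}))
      \<le> (\<Sum>z\<in>ends. card {w. ends_arc z w} - (real \<delta> - card (C - ends)))"
  proof (rule sum_mono)
    fix z assume z: "z \<in> ends"
    have "card (C - ends) = card ({y \<in> C - ends. \<not> E z y} \<union> {y \<in> C - ends. E z y})"
      by (rule arg_cong[of _ _ card]) auto
    also have "\<dots> = card {y \<in> C - ends. \<not> E z y} + card {y \<in> C - ends. E z y}"
      by (rule card_Un_disjoint) auto
    finally show "real (card {y \<in> C - ends. \<not> E z y}) \<le> card {w. ends_arc z w} - (real \<delta> - card (C - ends))"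
      using deg_ends[OF z] ends_arc_card[OF z] by linarith
  qed
  also have "\<dots> = card {(u, v). ends_arc u v} - (real \<delta> - card (C - ends)) * card ends"
    by (simp only: sum_subtractf ends.card_arcs) (simp add: algebra_simps)
  finally show ?thesis by (subst non_arcs_swap[symmetric]) simp_all
qed

text \<open>\<open>M\<close> bounds the non-arcs from \<open>ends\<close> to
  \<open>C - ends\<close>. Absence of triangles limits the set \<open>J\<close> of places where the
  cycle passes from \<open>C - ends\<close> to \<open>ends\<close>, while
  \<open>non_in_neighbours\<close> forces non-arcs after every vertex of
  \<open>C - ends\<close>.\<close>

lemma non_arcs_count:
  fixes k M :: real
  assumes E3: "\<And>u v w. E u v \<Longrightarrow> E v w \<Longrightarrow> \<not> E w u"
  defines "k \<equiv> real \<delta> - card (C - ends)"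
  defines "M \<equiv> card {(u, v). ends_arc u v} - k * card ends"
  assumes k0: "k > 0"
  shows "k * (card (C - ends) * (k - card (ends - starts) - 1)) \<le> M * (k + card ends)"
proof -
  let ?F = "C - ends"
  define g where "g w = real (card {z \<in> ends. \<not> E z w})" for w
  have gM: "(\<Sum>y\<in>?F. g y) \<le> M"
    using non_arcs_leaving_ends unfolding g_def M_def k_def .
  define J where "J = {y \<in> ?F. nxt y \<in> ends}"
  have J: "finite J" "J \<subseteq> ?F" unfolding J_def by auto
  have Jk: "card J * k \<le> M"
  proof -
    have "card J * k = (\<Sum>y\<in>J. k)" by simp
    also have "\<dots> \<le> (\<Sum>y\<in>J. g y)"
    proof (rule sum_mono)
      fix y assume y: "y \<in> J"
      then have "E y (nxt y)" "nxt y \<in> ends" unfolding J_def using nxt_arc(1) by auto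
      \<comment> \<open>An arc from such a \<open>w\<close> to \<open>y\<close> would close the
        triangle \<open>y\<close>, \<open>nxt y\<close>, \<open>w\<close>.\<close>
      then have "{w \<in> ends. E (nxt y) w} \<subseteq> {z \<in> ends. \<not> E z y}" using E3 by blast
      then have "card {w \<in> ends. E (nxt y) w} \<le> card {z \<in> ends. \<not> E z y}" by (intro card_mono) auto
      then show "k \<le> g y" using deg_ends'[OF \<open>nxt y \<in> ends\<close>] unfolding k_def g_def by linarith
    qed
    also have "\<dots> \<le> (\<Sum>y\<in>?F. g y)" using J by (intro sum_mono2) (auto simp: g_def)
    finally show ?thesis using gM by linarith
  qed
  have "card ?F * (k - card (ends - starts) - 1) = (\<Sum>y\<in>?F. k - card (ends - starts) - 1)" by simp
  also have "\<dots> \<le> (\<Sum>y\<in>?F. g (nxt y))"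
  proof (rule sum_mono)
    fix y assume "y \<in> ?F"
    then show "k - card (ends - starts) - 1 \<le> g (nxt y)"
      using non_in_neighbours[of y] unfolding k_def g_def by simp
  qed
  \<comment> \<open>If \<open>nxt y\<close> is again outside \<open>ends\<close>, its non-arcs are
    among those bounded by \<open>M\<close>, once each by injectivity; on \<open>J\<close> the
    trivial bound \<open>card ends\<close> is used.\<close>
  also have "\<dots> = (\<Sum>y\<in>?F - J. g (nxt y)) + (\<Sum>y\<in>J. g (nxt y))"
    using J by (intro sum.subset_diff) auto
  also have "(\<Sum>y\<in>?F - J. g (nxt y)) \<le> M"
  proof -
    have "inj_on nxt (?F - J)" using nxt_inj by (rule inj_on_subset) auto
    then have "(\<Sum>y\<in>?F - J. g (nxt y)) = (\<Sum>w\<in>nxt ` (?F - J). g w)" by (simp add: sum.reindex)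
    also have "\<dots> \<le> (\<Sum>w\<in>?F. g w)"
      by (intro sum_mono2) (use nxt_arc(2) in \<open>auto simp: J_def g_def\<close>)
    finally show ?thesis using gM by linarith
  qed
  also have "(\<Sum>y\<in>J. g (nxt y)) \<le> (\<Sum>y\<in>J. real (card ends))"
    unfolding g_def by (intro sum_mono) (auto intro: card_mono)
  finally have "card ?F * (k - card (ends - starts) - 1) \<le> M + card J * real (card ends)" by simp
  then have "k * (card ?F * (k - card (ends - starts) - 1)) \<le> k * (M + card J * real (card ends))"
    using k0 by (intro mult_left_mono) auto
  also have "\<dots> = k * M + (card J * k) * card ends" by (simp add: algebra_simps)
  also have "\<dots> \<le> k * M + M * card ends" using Jk by (intro add_left_mono mult_right_mono) auto
  finally show ?thesis by (simp add: algebra_simps)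
qed

end

text \<open>
  In the application, \<open>d = \<delta>\<close>, \<open>t = 2\<delta> - l\<close>, \<open>n\<close> is the number of ends, \<open>d - k\<close> the number of other
  vertices of \<open>C\<close>, and \<open>M\<close> the excess of the number of arcs among the ends over \<open>k * n\<close>.
\<close>

lemma numeric_contradiction:
  fixes d n k t M :: real
  assumes d: "d > 0" and t: "t > (3465 / 10000) * d" and kt: "t \<le> k" and n: "n > 0" "n \<le> d - t + k"
    and M: "0 \<le> M" "9 * M \<le> n * (11 * n - 11 - 31 * k)"
    and nonarcs: "k * ((d - k) * (t - 1)) \<le> M * (k + n)"
  shows False
proof -
  have "0 \<le> n * (11 * n - 11 - 31 * k)" using M by linarith
  then have 1: "11 * n - 11 - 31 * k \<ge> 0" using n(1) by (simp add: zero_le_mult_iff)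
  \<comment> \<open>Together, \<open>11 * n \<ge> 31 * k + 11\<close> and
    \<open>n \<le> d - t + k\<close> give \<open>20 * k \<le> 11 * (d - t) - 11\<close>.\<close>
  have k: "k \<le> (3595 / 10000) * d" using 1 n(2) t d by linarith
  have n': "n \<le> (1013 / 1000) * d" using k n(2) t by linarith
  have b: "11 * n - 11 - 31 * k \<le> (2585 / 10000) * d - 11" using n(2) t kt by linarith
  \<comment> \<open>Large enough for the 1 in \<open>t - 1\<close> to cost less than
    \<open>(265 / 10000) * d\<close>, which leaves \<open>(32 / 100) * d\<close>.\<close>
  then have d42: "d \<ge> 42" using 1 by linarith
  have k0: "k > 0" using kt t d by linarith
  have "n * (11 * n - 11 - 31 * k) \<le> ((1013 / 1000) * d) * ((2585 / 10000) * d)"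
    using n' b 1 n d by (intro mult_mono) auto
  then have "9 * M \<le> (1013 / 1000 * d) * (2585 / 10000 * d)" using M(2) by (rule order_trans[rotated])
  then have "18000000 * M \<le> 523721 * (d * d)" by simp
  then have M': "M \<le> (291 / 10000) * (d * d)" using zero_le_square[of d] by linarith
  have kn: "k + n \<le> (393 / 100) * k" using n' kt t k0 by linarith
  have "M * (k + n) \<le> ((291 / 10000) * (d * d)) * ((393 / 100) * k)"
    using M' kn M(1) k0 n by (intro mult_mono) auto
  moreover have "((6405 / 10000) * d) * ((32 / 100) * d) \<le> (d - k) * (t - 1)"
    using k t d42 by (intro mult_mono) auto
  then have "k * (((6405 / 10000) * d) * ((32 / 100) * d)) \<le> k * ((d - k) * (t - 1))"
    using k0 by (intro mult_left_mono) auto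
  ultimately have "k * (((6405 / 10000) * d) * ((32 / 100) * d)) \<le> ((291 / 10000) * (d * d)) * ((393 / 100) * k)"
    using nonarcs by linarith
  moreover have "k * (((6405 / 10000) * d) * ((32 / 100) * d)) = 20496 / 100000 * (k * (d * d))"
    "((291 / 10000) * (d * d)) * ((393 / 100) * k) = 114363 / 1000000 * (k * (d * d))" by simp_all
  moreover have "k * (d * d) > 0" using k0 d by simp
  ultimately show False by linarith
qed

context rotation
begin

lemma triangle_free_bound:
  assumes E3: "\<And>u v w. E u v \<Longrightarrow> E v w \<Longrightarrow> \<not> E w u"
    and d0: "\<delta> > 0"
    and a: "a \<ge> 1" "card {y \<in> C. E x y} + a \<ge> \<delta> + 1"
  shows "real (a + card C - 1) \<ge> 1.6535 * \<delta>"
proof (rule ccontr)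
  assume neg: "\<not> ?thesis"
  define k where "k = real \<delta> - card (C - ends)"
  define n where "n = real (card ends)"
  define m where "m = real (card {(u, v). ends_arc u v})"
  \<comment> \<open>This is \<open>2 * \<delta> - l\<close> for \<open>l = a + card C - 1\<close>;
    below, \<open>0.3465 = 2 - 1.6535\<close>.\<close>
  define t where "t = 2 * real \<delta> + 1 - a - card C"
  have t: "t > 3465 / 10000 * \<delta>" using neg a(1) unfolding t_def by (simp add: of_nat_diff)
  have S: "n = card starts + card (ends - starts)"
  proof -
    have "card ends = card starts + card (ends - starts)"
      using starts_subset_ends finite_ends by (metis card_Diff_subset card_mono finite_subset le_add_diff_inverse)
    then show ?thesis unfolding n_def by simp
  qed
  have c: "real (card C) = n + (\<delta> - k)" using card_C unfolding n_def k_def by simp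
  have "real (card starts) + a \<ge> \<delta> + 1" using a(2) unfolding card_starts[symmetric] by linarith
  \<comment> \<open>\<open>starts\<close> has at least \<open>\<delta> + 1 - a\<close> elements, and
    \<open>n = card C - \<delta> + k\<close>.\<close>
  then have St: "real (card (ends - starts)) \<le> k - t" using S c unfolding t_def by simp
  have kt: "t \<le> k" using St by linarith
  have k0: "k > 0" 
  proof -
    have "0 < 3465 / 10000 * real \<delta>" using d0 by simp
    then show ?thesis using kt t by linarith
  qed
  have n2: "n \<le> \<delta> - t + k" using c a(1) unfolding t_def by simp
  have n1: "n > 0" using ends_nonempty unfolding n_def by (simp add: card_gt_0_iff)
  have "9 * m \<le> 11 * (n * (n - 1 - 2 * k))"
    unfolding m_def n_def
  proof (rule ends.arc_density_le[OF ends_nonempty])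
    show "\<And>v. v \<in> ends \<Longrightarrow> k \<le> card {w. ends_arc v w}" using deg_ends' ends_arc_card unfolding k_def by simp
  qed (use antisym E3 k0 in blast)+
  then have M2: "9 * (m - k * n) \<le> n * (11 * n - 11 - 31 * k)" by (simp add: algebra_simps)
  have M1: "0 \<le> m - k * n" using arcs_within_ends unfolding m_def k_def n_def by simp
  have f: "real (card (C - ends)) = \<delta> - k" unfolding k_def by simp
  have "k * ((\<delta> - k) * (t - 1)) \<le> k * ((\<delta> - k) * (k - card (ends - starts) - 1))"
    using k0 St f by (intro mult_left_mono) (auto simp flip: f)
  also have "\<dots> \<le> (m - k * n) * (k + n)"
    using non_arcs_count[OF E3] k0 unfolding m_def n_def f[symmetric] k_def by simp
  finally show False
    using numeric_contradiction[OF _ t kt n1 n2 M1 M2] d0 by simp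
qed

end

section \<open>Long paths\<close>

text \<open>\<open>terminal\<close> expresses strong connectivity: no proper nonempty subset is
  closed under out-neighbours.\<close>

locale terminal_digraph = digraph_on +
  fixes \<delta> :: nat
  assumes terminal: "X \<subseteq> V \<Longrightarrow> X \<noteq> {} \<Longrightarrow> (\<And>u v. u \<in> X \<Longrightarrow> E u v \<Longrightarrow> v \<in> X) \<Longrightarrow> X = V"
    and nonempty: "V \<noteq> {}"
    and min_deg: "v \<in> V \<Longrightarrow> \<delta> \<le> card {w. E v w}"
    and min_deg_pos: "\<delta> > 0"
    and oriented: "E u v \<Longrightarrow> \<not> E v u"
begin

text \<open>Given by vertices, so the length in arcs is \<open>length ps - 1\<close>.\<close>

definition path :: "'a list \<Rightarrow> bool" where
  "path ps \<longleftrightarrow> ps \<noteq> [] \<and> distinct ps \<and> set ps \<subseteq> V \<and> successively E ps"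

definition is_cycle :: "'a list \<Rightarrow> bool" where
  "is_cycle cs \<longleftrightarrow> path cs \<and> E (last cs) (hd cs)"

lemma path_append:
  "path (ps @ qs) \<longleftrightarrow> path ps \<and> path qs \<and> set ps \<inter> set qs = {} \<and> E (last ps) (hd qs)"
  if "ps \<noteq> []" "qs \<noteq> []"
  using that unfolding path_def by (auto simp: successively_append_iff)

lemma is_cycle_rotate: "is_cycle (ps @ qs) \<Longrightarrow> is_cycle (qs @ ps)"
  by (cases "ps = []"; cases "qs = []")
    (auto simp: is_cycle_def path_append)

lemma cycle_rotate_last:
  assumes "is_cycle cs" "u \<in> set cs"
  obtains ds where "is_cycle ds" "set ds = set cs" "length ds = length cs" "last ds = u"
proof -
  obtain p q where "cs = p @ u # q" using assms(2) by (meson split_list)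
  then have "is_cycle (q @ (p @ [u]))" using assms(1) is_cycle_rotate[of "p @ [u]" q] by simp
  then show thesis using that[of "q @ p @ [u]"] \<open>cs = p @ u # q\<close> by auto
qed

lemma cycle_rotate_hd:
  assumes "is_cycle cs" "u \<in> set cs"
  obtains ds where "is_cycle ds" "set ds = set cs" "length ds = length cs" "hd ds = u"
proof -
  obtain p q where "cs = p @ u # q" using assms(2) by (meson split_list)
  then have "is_cycle ((u # q) @ p)" using assms(1) is_cycle_rotate[of p "u # q"] by simp
  then show thesis using that[of "(u # q) @ p"] \<open>cs = p @ u # q\<close> by auto
qed

lemma path_length_le: "path ps \<Longrightarrow> length ps \<le> card V"
  unfolding path_def by (metis card_mono distinct_card finite_V)

lemma out_nbr_exists: "v \<in> V \<Longrightarrow> \<exists>w. E v w"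
  using min_deg[of v] min_deg_pos by (metis card.empty empty_Collect_eq leD)

section \<open>Connecting paths and cycles\<close>

lemma reachable:
  assumes "a \<in> V" "b \<in> V"
  shows "E\<^sup>*\<^sup>* a b"
proof -
  have "{v \<in> V. E\<^sup>*\<^sup>* a v} = V"
  proof (rule terminal)
    show "{v \<in> V. E\<^sup>*\<^sup>* a v} \<noteq> {}" using assms by blast
    fix u v assume "u \<in> {v \<in> V. E\<^sup>*\<^sup>* a v}" "E u v"
    then show "v \<in> {v \<in> V. E\<^sup>*\<^sup>* a v}" using arc_in_V by (auto intro: rtranclp.rtrancl_into_rtrancl)
  qed auto
  then show ?thesis using assms by blast
qed

text \<open>Take \<open>ms\<close> of least length: a repetition, or an inner vertex in
  \<open>A\<close> or \<open>B\<close>, would allow a shorter list.\<close>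

lemma connecting_path:
  assumes "A \<subseteq> V" "A \<noteq> {}" "B \<subseteq> V" "B \<noteq> {}" "A \<inter> B = {}"
  obtains a b ms where "a \<in> A" "b \<in> B" "successively E (a # ms @ [b])" "distinct ms" "set ms \<inter> (A \<union> B) = {}"
proof -
  define P where "P ms \<longleftrightarrow> (\<exists>a\<in>A. \<exists>b\<in>B. successively E (a # ms @ [b]))" for ms
  have walk: "\<exists>ws. ws \<noteq> [] \<and> hd ws = u \<and> last ws = v \<and> successively E ws" if "E\<^sup>*\<^sup>* u v" for u v
    using that
  proof (induction rule: converse_rtranclp_induct)
    case base
    show ?case by (rule exI[of _ "[v]"]) simp
  next
    case (step y z)
    then obtain ws where "ws \<noteq> []" "hd ws = z" "last ws = v" "successively E ws" by blast
    with step(1) show ?case by (intro exI[of _ "y # ws"]) (auto simp: successively_Cons)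
  qed
  obtain a b where ab: "a \<in> A" "b \<in> B" using assms by blast
  then obtain ws where ws: "ws \<noteq> []" "hd ws = a" "last ws = b" "successively E ws"
    using walk[OF reachable] assms by (metis subsetD)
  have "a \<noteq> b" using ab assms by blast
  then obtain ms where "ws = a # ms @ [b]"
    using ws by (cases ws; cases "tl ws" rule: rev_cases) auto
  then have "P ms" using ws ab unfolding P_def by blast
  then obtain ms where ms: "P ms" "\<And>ns. P ns \<Longrightarrow> length ms \<le> length ns"
    using ex_has_least_nat[of P ms length] by blast
  then obtain a b where ab: "a \<in> A" "b \<in> B" "successively E (a # ms @ [b])" unfolding P_def by blast
  show thesis
  proof
    show "a \<in> A" "b \<in> B" "successively E (a # ms @ [b])" using ab by auto
    show "distinct ms"
    proof (rule ccontr)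
      assume "\<not> distinct ms"
      then obtain p m q r where d: "ms = p @ [m] @ q @ [m] @ r" using not_distinct_decomp by blast
      have "successively E (a # (p @ [m] @ r) @ [b])"
        using ab(3) unfolding d by (auto simp: successively_append_iff successively_Cons hd_append split: if_splits)
      then have "P (p @ [m] @ r)" unfolding P_def using ab by blast
      from ms(2)[OF this] show False unfolding d by simp
    qed
    show "set ms \<inter> (A \<union> B) = {}"
    proof (rule ccontr)
      assume "\<not> ?thesis"
      then obtain m where m: "m \<in> set ms" "m \<in> A \<or> m \<in> B" by blast
      then obtain p q where d: "ms = p @ m # q" by (meson split_list)
      have "successively E (m # q @ [b])" "successively E (a # p @ [m])"
        using ab(3) unfolding d by (auto simp: successively_append_iff successively_Cons hd_append split: if_splits)
      then have "P p \<or> P q" unfolding P_def using ab m by blast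
      then show False using ms(2) unfolding d by force
    qed
  qed
qed

text \<open>Go round \<open>cs\<close> up to the vertex where a connecting path leaves it, follow
  that path, then go round \<open>ds\<close>.\<close>

lemma path_through_disjoint_cycles:
  assumes "is_cycle cs" "is_cycle ds" "set cs \<inter> set ds = {}"
  shows "\<exists>ps. path ps \<and> length cs + length ds \<le> length ps"
proof -
  have c: "set cs \<subseteq> V" "set cs \<noteq> {}" "set ds \<subseteq> V" "set ds \<noteq> {}"
    using assms unfolding is_cycle_def path_def by auto
  obtain a b ms where abm: "a \<in> set cs" "b \<in> set ds" "successively E (a # ms @ [b])" "distinct ms"
    "set ms \<inter> (set cs \<union> set ds) = {}"
    using connecting_path[OF c assms(3)] .
  obtain cs' where cs': "is_cycle cs'" "set cs' = set cs" "length cs' = length cs" "last cs' = a"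
    using cycle_rotate_last[OF assms(1) abm(1)] .
  obtain ds' where ds': "is_cycle ds'" "set ds' = set ds" "length ds' = length ds" "hd ds' = b"
    using cycle_rotate_hd[OF assms(2) abm(2)] .
  have ne: "cs' \<noteq> []" "ds' \<noteq> []" using cs' ds' unfolding is_cycle_def path_def by auto
  have msV: "set ms \<subseteq> V"
  proof
    fix m assume "m \<in> set ms"
    then obtain p q where "ms = p @ m # q" by (meson split_list)
    then show "m \<in> V" using abm(3) arc_in_V
      by (cases q) (auto simp: successively_append_iff successively_Cons)
  qed
  have "successively E (cs' @ ms @ ds')"
    using abm(3) cs' ds' ne unfolding is_cycle_def path_def
    by (cases "ms = []") (auto simp: successively_append_iff successively_Cons)
  then have "path (cs' @ ms @ ds')"
    using cs' ds' abm assms(3) c msV unfolding is_cycle_def path_def by auto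
  then show ?thesis using cs' ds' by (intro exI[of _ "cs' @ ms @ ds'"]) simp
qed

text \<open>From the first out-neighbour of \<open>last ps\<close> on, the path closes to a cycle
  that contains \<open>last ps\<close> and all its out-neighbours.\<close>

lemma closing_cycle:
  assumes "path ps" "\<And>w. E (last ps) w \<Longrightarrow> w \<in> set ps"
  obtains p cs where "ps = p @ cs" "is_cycle cs" "\<delta> + 1 \<le> length cs"
proof -
  have l: "last ps \<in> V" using assms unfolding path_def by auto
  then have "\<exists>y\<in>set ps. E (last ps) y" using out_nbr_exists assms(2) by blast
  then obtain p y r where d: "ps = p @ y # r" "E (last ps) y" "\<forall>z\<in>set p. \<not> E (last ps) z"
    using split_list_first_prop by (metis (full_types))
  have pc: "path (y # r)" using assms(1) d(1) by (cases "p = []") (auto simp: path_append)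
  have c: "is_cycle (y # r)" using pc d unfolding is_cycle_def by auto
  have "w \<in> set (y # r)" if "E (last ps) w" for w
    using assms(2)[OF that] d(3) that unfolding d(1) set_append by blast
  moreover have "last ps \<in> set (y # r)" unfolding d(1) by simp
  ultimately have "insert (last ps) {w. E (last ps) w} \<subseteq> set (y # r)" by blast
  then have "card (insert (last ps) {w. E (last ps) w}) \<le> card (set (y # r))" by (intro card_mono) auto
  moreover have "last ps \<notin> {w. E (last ps) w}" using oriented by blast
  ultimately have "1 + card {w. E (last ps) w} \<le> length (y # r)"
    using pc unfolding path_def by (metis card_insert_disjoint distinct_card finite_nbrs(1) plus_1_eq_Suc)
  then show thesis using that[OF d(1) c] min_deg[OF l] by simp
qed

lemma card_V: "2 * \<delta> + 1 \<le> card V"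
proof -
  have "real \<delta> * card V \<le> card {(u, v). E u v}" using min_deg by (intro card_arcs_ge) simp
  moreover have "{(u, v). u \<in> V \<and> v \<in> V \<and> E u v} = {(u, v). E u v}" using arc_in_V by auto
  then have "real (2 * card {(u, v). E u v} + card V) \<le> real (card V * card V)"
    using card_antisym_arcs[of V E, OF finite_V oriented] by (simp only: of_nat_le_iff)
  ultimately have "card V * (2 * real \<delta> + 1) \<le> card V * real (card V)" by (simp add: algebra_simps)
  then have "real (2 * \<delta> + 1) \<le> real (card V)"
    using nonempty finite_V by (simp add: card_gt_0_iff)
  then show ?thesis by (simp only: of_nat_le_iff)
qed

lemma long_path:
  "\<exists>ps. path ps \<and> 2 * (length ps - 1) \<ge> 3 * \<delta> \<and>
    ((\<forall>u v w. E u v \<longrightarrow> E v w \<longrightarrow> \<not> E w u) \<longrightarrow> real (length ps - 1) \<ge> 1.6535 * \<delta>)"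
proof -
  obtain v0 where "v0 \<in> V" using nonempty by blast
  then have "path [v0]" unfolding path_def by simp
  then have "\<exists>P. path P \<and> (\<forall>qs. path qs \<longrightarrow> length qs \<le> length P)"
    by (rule ex_has_greatest_nat[where b = "Suc (card V)"]) (use path_length_le in \<open>simp add: less_Suc_eq_le\<close>)
  then obtain P where P: "path P" "\<And>qs. path qs \<Longrightarrow> length qs \<le> length P" by blast
  \<comment> \<open>Length \<open>2 * \<delta>\<close> satisfies both bounds.\<close>
  have goal: ?thesis if "length P \<ge> 2 * \<delta> + 1"
    using P(1) that by (intro exI[of _ P]) auto
  have last_in: "w \<in> set ps" if "path ps" "length ps = length P" "E (last ps) w" for ps w
  proof (rule ccontr)
    assume "w \<notin> set ps"
    then have "path (ps @ [w])"
      using that arc_in_V unfolding path_def by (auto simp: successively_append_iff)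
    then show False using P(2)[of "ps @ [w]"] that by simp
  qed
  \<comment> \<open>\<open>n\<close> is the number of vertices before the part that closes to a
    cycle; it is minimised over all longest paths.\<close>
  define L where "L n \<longleftrightarrow> (\<exists>qs cs. length qs = n \<and> path (qs @ cs) \<and> length (qs @ cs) = length P \<and> is_cycle cs)" for n
  have "\<exists>n. L n"
  proof -
    obtain p cs where "P = p @ cs" "is_cycle cs" using closing_cycle[OF P(1)] last_in[OF P(1)] by blast
    then show ?thesis unfolding L_def using P(1) by blast
  qed
  then obtain n where n: "L n" "\<And>j. j < n \<Longrightarrow> \<not> L j" using exists_least_iff[of L] by blast
  then obtain qs cs where qc: "length qs = n" "path (qs @ cs)" "length (qs @ cs) = length P" "is_cycle cs"
    unfolding L_def by blast
  have csne: "cs \<noteq> []" using qc unfolding is_cycle_def path_def by simp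
  \<comment> \<open>An out-neighbour in \<open>qs\<close> would close a larger cycle behind a
    shorter initial segment.\<close>
  have end_nbr: "w \<in> set cs"
    if zs: "path (qs @ zs)" "set zs = set cs" "length zs = length cs" "E (last zs) w" for zs w
  proof (rule ccontr)
    assume w: "w \<notin> set cs"
    have zne: "zs \<noteq> []" using zs(2) csne by auto
    have "w \<in> set (qs @ zs)" using last_in[OF zs(1)] zs qc zne by simp
    then have "w \<in> set qs" using w zs by simp
    then obtain q1 q2 where d: "qs = q1 @ w # q2" by (meson split_list)
    have "path (w # q2 @ zs)" using zs(1) d by (cases "q1 = []") (auto simp: path_append)
    then have "is_cycle (w # q2 @ zs)" using zs(4) zne unfolding is_cycle_def by simp
    then have "L (length q1)" unfolding L_def using zs(1) d qc zs(3)
      by (intro exI[of _ q1] exI[of _ "w # q2 @ zs"]) auto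
    then show False using n(2) qc(1) d by simp
  qed
  show ?thesis
  proof (cases "qs = []")
    case True
    \<comment> \<open>Without an initial segment every vertex of the cycle ends a longest path, so
      the cycle is closed under out-neighbours.\<close>
    have "set cs = V"
    proof (rule terminal)
      show "set cs \<subseteq> V" "set cs \<noteq> {}" using qc csne unfolding is_cycle_def path_def by auto
      fix u v assume uv: "u \<in> set cs" "E u v"
      obtain ds where ds: "is_cycle ds" "set ds = set cs" "length ds = length cs" "last ds = u"
        using cycle_rotate_last[OF qc(4) uv(1)] .
      then show "v \<in> set cs" using last_in[of ds v] uv qc True unfolding is_cycle_def by auto
    qed
    then have "card V = length P" using qc True unfolding path_def by (metis append_Nil distinct_card)
    then show ?thesis using goal card_V by simp
  next
    case False
    define x where "x = last qs"
    have pqs: "path qs" "E x (hd cs)" "set qs \<inter> set cs = {}"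
      using qc False csne unfolding x_def by (auto simp: path_append)
    have xV: "x \<in> V" using pqs arc_in_V by blast
    have zs_path: "path (qs @ zs)" "length zs = length cs"
      if zs: "distinct zs" "set zs = set cs" "successively E zs" "E x (hd zs)" for zs
    proof -
      have "path zs" using zs csne qc unfolding path_def is_cycle_def by auto
      then show "path (qs @ zs)" using pqs zs False path_append[of qs zs] unfolding x_def path_def by auto
      show "length zs = length cs" using zs qc(4) unfolding is_cycle_def path_def by (metis distinct_card)
    qed
    interpret rotation V E x cs \<delta>
    proof unfold_locales
      show "cs \<noteq> []" "distinct cs" "successively E cs" "E (last cs) (hd cs)"
        using qc unfolding is_cycle_def path_def by auto
      show "\<exists>y\<in>set cs. E x y" using pqs csne by (metis hd_in_set)
      show "w \<in> set cs" if "distinct zs" "set zs = set cs" "successively E zs" "E x (hd zs)" "E (last zs) w" for zs w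
        using end_nbr[OF zs_path(1)] zs_path(2) that by blast
    qed (use min_deg oriented in blast)+
    show ?thesis
    proof (cases "\<exists>w. E x w \<and> w \<notin> set qs \<union> set cs")
      case True
      \<comment> \<open>leaving through \<open>w\<close> produces a second cycle, disjoint from \<open>C\<close>, also with more than \<open>\<delta>\<close> vertices\<close>
      then obtain w where w: "E x w" "w \<notin> set qs \<union> set cs" by blast
      define R where "R rs \<longleftrightarrow> rs \<noteq> [] \<and> path (qs @ rs) \<and> set rs \<inter> set cs = {}" for rs
      have "R [w]" using w pqs False arc_in_V unfolding R_def x_def
        by (auto simp: path_append path_def successively_append_iff)
      moreover have "length rs \<le> card V" if "R rs" for rs
        using path_length_le[of "qs @ rs"] that unfolding R_def by simp
      ultimately have "\<exists>rs. R rs \<and> (\<forall>rs'. R rs' \<longrightarrow> length rs' \<le> length rs)"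
        by (intro ex_has_greatest_nat[where b = "Suc (card V)"]) (auto simp: less_Suc_eq_le)
      then obtain rs where rs: "R rs" "\<And>rs'. R rs' \<Longrightarrow> length rs' \<le> length rs" by blast
      have rs': "rs \<noteq> []" "path (qs @ rs)" "set rs \<inter> set cs = {}" using rs(1) unfolding R_def by auto
      \<comment> \<open>If the end of \<open>rs\<close> had an arc to \<open>C\<close>, going once
        round \<open>C\<close> would beat the longest path; any other new vertex would extend
        \<open>rs\<close>.\<close>
      have "v \<in> set (qs @ rs)" if v: "E (last (qs @ rs)) v" for v
      proof (rule ccontr)
        assume nv: "v \<notin> set (qs @ rs)"
        have vV: "v \<in> V" using v arc_in_V by blast
        show False
        proof (cases "v \<in> set cs")
          case True
          obtain ds where ds: "is_cycle ds" "set ds = set cs" "length ds = length cs" "hd ds = v"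
            using cycle_rotate_hd[OF qc(4) True] .
          have "ds \<noteq> []" using ds csne by auto
          then have "path ((qs @ rs) @ ds)"
            using path_append[of "qs @ rs" ds] ds rs' v pqs(3) unfolding is_cycle_def by auto
          from P(2)[OF this] show False using qc(3) ds(3) rs'(1) by (cases rs) auto
        next
          case False
          then have "R (rs @ [v])" using rs' nv v vV unfolding R_def
            by (auto simp: path_def successively_append_iff)
          from rs(2)[OF this] show False by simp
        qed
      qed
      from closing_cycle[OF rs'(2) this] obtain p ds where
        ds: "qs @ rs = p @ ds" "is_cycle ds" "\<delta> + 1 \<le> length ds" by blast
      have "set ds \<inter> set cs = {}"
      proof -
        have "set ds \<subseteq> set (qs @ rs)" unfolding ds(1) by simp
        then show ?thesis using rs' pqs by auto
      qed
      then obtain ps where ps: "path ps" "length ds + length cs \<le> length ps"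
        using path_through_disjoint_cycles[OF ds(2) qc(4)] by blast
      moreover have "\<delta> + 1 \<le> length cs"
      proof -
        have "E (last cs) v \<Longrightarrow> v \<in> set cs" for v using end_nbr[of cs v] qc by blast
        then have "insert (last cs) {v. E (last cs) v} \<subseteq> set cs" using csne by auto
        then have "card (insert (last cs) {v. E (last cs) v}) \<le> length cs"
          by (meson List.finite_set card_length card_mono order_trans)
        moreover have "last cs \<notin> {v. E (last cs) v}" using oriented by blast
        moreover have "\<delta> \<le> card {v. E (last cs) v}"
          by (rule min_deg) (use qc csne in \<open>auto simp: is_cycle_def path_def\<close>)
        ultimately show ?thesis by (simp add: card_insert_disjoint)
      qed
      ultimately have "2 * \<delta> + 1 \<le> length P" using ds(3) P(2)[OF ps(1)] by linarith
      then show ?thesis by (rule goal)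
    next
      case outs: False
      \<comment> \<open>At most \<open>length qs - 1\<close> out-neighbours of \<open>x\<close>
        precede it; the others lie on the cycle. In the rotation bounds, \<open>a\<close> is
        \<open>length qs\<close>.\<close>
      have "{w. E x w} \<subseteq> {y \<in> set cs. E x y} \<union> (set qs - {x})" using outs oriented by blast
      then have "card {w. E x w} \<le> card ({y \<in> set cs. E x y} \<union> (set qs - {x}))"
        by (intro card_mono) auto
      also have "\<dots> \<le> card {y \<in> set cs. E x y} + card (set qs - {x})" by (rule card_Un_le)
      also have "card (set qs - {x}) = length qs - 1"
        using False pqs(1) unfolding x_def path_def by (simp add: distinct_card)
      finally have a: "\<delta> + 1 \<le> card {y \<in> set cs. E x y} + length qs"
        using min_deg[OF xV] False by (cases qs) auto
      have lq: "length qs \<ge> 1" using False by (cases qs) auto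
      have "card (set cs) = length cs" using cyc(2) by (rule distinct_card)
      then have lP: "length qs + card (set cs) - 1 = length P - 1" using qc(3) by simp
      have "3 * \<delta> \<le> 2 * (length P - 1)" using oriented_bound[OF lq] a lP by simp
      moreover have "1.6535 * \<delta> \<le> real (length P - 1)"
        if "\<forall>u v w. E u v \<longrightarrow> E v w \<longrightarrow> \<not> E w u"
        using triangle_free_bound[OF _ min_deg_pos lq] that a unfolding lP by blast
      ultimately show ?thesis using P(1) by blast
    qed
  qed
qed

end

section \<open>Reduction to a terminal strong component\<close>

lemma (in digraph_on) long_path_exists:
  assumes "V \<noteq> {}" and deg: "\<And>v. v \<in> V \<Longrightarrow> \<delta> \<le> card {w. E v w}" and "\<delta> > 0"
    and antisym: "\<And>u v. E u v \<Longrightarrow> \<not> E v u"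
  shows "\<exists>ps. ps \<noteq> [] \<and> distinct ps \<and> set ps \<subseteq> V \<and> successively E ps \<and>
    2 * (length ps - 1) \<ge> 3 * \<delta> \<and>
    ((\<forall>u v w. E u v \<longrightarrow> E v w \<longrightarrow> \<not> E w u) \<longrightarrow> real (length ps - 1) \<ge> 1.6535 * \<delta>)"
proof -
  \<comment> \<open>a minimal nonempty out-closed set is a terminal strong component\<close>
  define P where "P W \<longleftrightarrow> W \<subseteq> V \<and> W \<noteq> {} \<and> (\<forall>u v. u \<in> W \<longrightarrow> E u v \<longrightarrow> v \<in> W)" for W
  have "P V" using assms arc_in_V unfolding P_def by blast
  then have "\<exists>W. P W \<and> (\<forall>X. P X \<longrightarrow> card W \<le> card X)" by (rule ex_has_least_nat)
  then obtain W where W: "P W" "\<And>X. P X \<Longrightarrow> card W \<le> card X" by blast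
  define F where "F u v \<longleftrightarrow> u \<in> W \<and> v \<in> W \<and> E u v" for u v
  have WV: "W \<subseteq> V" "W \<noteq> {}" "finite W" using W(1) finite_V finite_subset unfolding P_def by auto
  have out: "{w. F v w} = {w. E v w}" if "v \<in> W" for v
    using W(1) that unfolding P_def F_def by blast
  interpret terminal_digraph W F \<delta>
  proof unfold_locales
    fix X assume X: "X \<subseteq> W" "X \<noteq> {}" and cl: "\<And>u v. u \<in> X \<Longrightarrow> F u v \<Longrightarrow> v \<in> X"
    have "P X" unfolding P_def
    proof (intro conjI allI impI)
      fix u v assume uv: "u \<in> X" "E u v"
      then have "F u v" using out[of u] X(1) by blast
      then show "v \<in> X" using cl uv by blast
    qed (use X WV in auto)
    then have "card W \<le> card X" by (rule W(2))
    then show "X = W" using card_seteq[OF WV(3) X(1)] by simp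
  next
    show "\<delta> \<le> card {w. F v w}" if "v \<in> W" for v using out[OF that] deg[of v] that WV by auto
  qed (use WV assms antisym in \<open>auto simp: F_def\<close>)
  obtain ps where ps: "path ps" "2 * (length ps - 1) \<ge> 3 * \<delta>"
    "(\<forall>u v w. F u v \<longrightarrow> F v w \<longrightarrow> \<not> F w u) \<longrightarrow> real (length ps - 1) \<ge> 1.6535 * \<delta>"
    using long_path by blast
  have "successively E ps" using ps(1) unfolding path_def
    by (auto intro: successively_mono simp: F_def)
  then show ?thesis using ps WV unfolding path_def F_def by blast
qed

section \<open>Transfer to arc lists, and girth\<close>

lemma (in wf_digraph) apath_of_vertices:
  assumes "distinct (u # vs)" "u \<in> verts G" "successively (\<lambda>u v. (u, v) \<in> arcs_ends G) (u # vs)"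
  shows "\<exists>p v. apath u p v \<and> awalk_verts u p = u # vs"
  using assms
proof (induction vs arbitrary: u)
  case Nil
  then show ?case by (intro exI[of _ "[]"]) (auto simp: apath_Nil_iff)
next
  case (Cons w vs)
  then obtain e where e: "e \<in> arcs G" "tail G e = u" "head G e = w"
    by (auto simp: arcs_ends_conv)
  obtain p v where p: "apath w p v" "awalk_verts w p = w # vs"
    using Cons.IH[of w] Cons.prems e by auto
  then have "apath u (e # p) v" using e Cons.prems by (auto simp: apath_Cons_iff)
  moreover have "awalk_verts u (e # p) = u # w # vs" using p e by simp
  ultimately show ?case by blast
qed

text \<open>Without parallel arcs, \<open>head\<close> is injective on the out-arcs of
  \<open>v\<close>.\<close>

lemma (in digraph) out_degree_eq: "out_degree G v = card {w. (v, w) \<in> arcs_ends G}"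
proof -
  have "inj_on (head G) (out_arcs G v)"
    by (rule inj_onI) (auto simp: arc_to_ends_def intro: no_multi_arcs)
  moreover have "head G ` out_arcs G v = {w. (v, w) \<in> arcs_ends G}"
    by (force simp: arcs_ends_conv)
  ultimately show ?thesis unfolding out_degree_def by (metis card_image)
qed

lemma (in digraph) long_apath_exists:
  assumes "verts G \<noteq> {}" "\<delta> \<le> min_out_degree G" "\<delta> > 0"
    and antisym: "\<And>u v. (u, v) \<in> arcs_ends G \<Longrightarrow> (v, u) \<notin> arcs_ends G"
  shows "\<exists>u p v. apath u p v \<and> 2 * length p \<ge> 3 * \<delta> \<and>
    ((\<forall>u v w. (u, v) \<in> arcs_ends G \<longrightarrow> (v, w) \<in> arcs_ends G \<longrightarrow> (w, u) \<notin> arcs_ends G)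
      \<longrightarrow> real (length p) \<ge> 1.6535 * \<delta>)"
proof -
  interpret digraph_on "verts G" "\<lambda>u v. (u, v) \<in> arcs_ends G"
    by unfold_locales (auto simp: arcs_ends_conv)
  have "\<delta> \<le> card {w. (v, w) \<in> arcs_ends G}" if "v \<in> verts G" for v
  proof -
    have "min_out_degree G \<le> out_degree G v" unfolding min_out_degree_def using that by (intro Min_le) auto
    then show ?thesis using assms out_degree_eq by simp
  qed
  from long_path_exists[OF assms(1) this assms(3) antisym]
  obtain ps where ps: "ps \<noteq> []" "distinct ps" "set ps \<subseteq> verts G"
    "successively (\<lambda>u v. (u, v) \<in> arcs_ends G) ps" "2 * (length ps - 1) \<ge> 3 * \<delta>"
    "(\<forall>u v w. (u, v) \<in> arcs_ends G \<longrightarrow> (v, w) \<in> arcs_ends G \<longrightarrow> (w, u) \<notin> arcs_ends G)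
      \<longrightarrow> real (length ps - 1) \<ge> 1.6535 * \<delta>"
    by blast
  obtain u vs where d: "ps = u # vs" using ps(1) by (cases ps) auto
  obtain p v where p: "apath u p v" "awalk_verts u p = u # vs"
    using apath_of_vertices[of u vs] ps unfolding d by auto
  have "length p = length ps - 1" using length_awalk_verts[of u p] p d by simp
  then show ?thesis using p ps by metis
qed

lemma (in digraph) girth_le_3_if_triangle:
  assumes "(u, v) \<in> arcs_ends G" "(v, w) \<in> arcs_ends G" "(w, u) \<in> arcs_ends G" "u \<noteq> w"
  shows "girth G \<le> enat 3"
proof -
  obtain e f g where efg: "e \<in> arcs G" "f \<in> arcs G" "g \<in> arcs G"
    "tail G e = u" "head G e = v" "tail G f = v" "head G f = w" "tail G g = w" "head G g = u"
    using assms by (auto simp: arcs_ends_conv)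
  have "awalk u [e, f, g] u" "distinct (tl (awalk_verts u [e, f, g]))"
    using efg no_loops[of e] no_loops[of f] no_loops[of g] by (auto simp: awalk_def)
  then have "cycle [e, f, g]" unfolding cycle_def by auto
  then have "girth G \<le> enat (length [e, f, g])" unfolding girth_def by (intro INF_lower) simp
  then show ?thesis by (simp add: eval_nat_numeral)
qed

lemma (in digraph) oriented_graph_if_girth:
  assumes "girth G > enat 2"
  shows "oriented_graph G"
proof unfold_locales
  fix p assume "cycle p"
  then have "girth G \<le> enat (length p)" unfolding girth_def by (intro INF_lower) simp
  then show "length p \<noteq> 2" using assms by auto
qed

theorem theorem2:
  fixes \<delta> :: nat
  assumes "\<delta> > 0"
  shows "(\<forall>D :: ('a, 'b) pre_digraph.
            oriented_graph D \<and> verts D \<noteq> {} \<and> min_out_degree D \<ge> \<delta> \<longrightarrow>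
            (\<exists>u p v. pre_digraph.apath D u p v \<and> real (length p) \<ge> 1.5 * real \<delta>)) \<and>
         (\<forall>D :: ('a, 'b) pre_digraph.
            digraph D \<and> verts D \<noteq> {} \<and> min_out_degree D \<ge> \<delta> \<and> girth D \<ge> 4 \<longrightarrow>
            (\<exists>u p v. pre_digraph.apath D u p v \<and> real (length p) \<ge> 1.6535 * real \<delta>))"
proof (intro conjI allI impI; elim conjE)
  fix D :: "('a, 'b) pre_digraph"
  assume D: "oriented_graph D" "verts D \<noteq> {}" "min_out_degree D \<ge> \<delta>"
  then have dig: "digraph D" and anti: "\<And>u v. (u, v) \<in> arcs_ends D \<Longrightarrow> (v, u) \<notin> arcs_ends D"
    by (auto simp: oriented_graph_iff)
  obtain u p v where "pre_digraph.apath D u p v" "2 * length p \<ge> 3 * \<delta>"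
    using digraph.long_apath_exists[OF dig D(2,3) assms anti] by blast
  moreover from this(2) have "real (length p) \<ge> 1.5 * real \<delta>" by simp
  ultimately show "\<exists>u p v. pre_digraph.apath D u p v \<and> real (length p) \<ge> 1.5 * real \<delta>" by blast
next
  fix D :: "('a, 'b) pre_digraph"
  assume D: "digraph D" "verts D \<noteq> {}" "min_out_degree D \<ge> \<delta>" "girth D \<ge> 4"
  interpret digraph D by fact
  have g: "enat k < girth D" if "k < 4" for k
    using that D(4) by (simp add: numeral_eq_enat order_less_le_trans[of "enat k" "enat 4"])
  have "oriented_graph D" using g[of 2] by (intro oriented_graph_if_girth) simp
  then have anti: "\<And>u v. (u, v) \<in> arcs_ends D \<Longrightarrow> (v, u) \<notin> arcs_ends D"
    by (auto simp: oriented_graph_iff)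
  have "(w, u) \<notin> arcs_ends D" if "(u, v) \<in> arcs_ends D" "(v, w) \<in> arcs_ends D" for u v w
    \<comment> \<open>Here \<open>u \<noteq> w\<close>, since otherwise there would be a
      2-cycle.\<close>
    using girth_le_3_if_triangle[OF that] g[of 3] that anti by fastforce
  then show "\<exists>u p v. apath u p v \<and> real (length p) \<ge> 1.6535 * real \<delta>"
    using long_apath_exists[OF D(2,3) assms anti] by blast
qed

end
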